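(* For triples $X_i=(A_i,G_i,H_i)$ of matrices in $\mathbb{C}^{n\times n}$ with $G_i$ and $H_i$ Hermitian positive definite, define $\Delta_{a,b}=(I+G_aH_b)^{-1}$ and $$F(X_a,X_b)=\begin{bmatrix} A_b\Delta_{a,b}A_a\\ G_b+A_b\Delta_{a,b}G_aA_b^H\\ H_a+A_a^HH_b\Delta_{a,b}A_a\end{bmatrix}.$$ Then for all such triples $X_a,X_b,X_c$ for which all the expressions involved are well-defined, $$F(F(X_a,X_b),X_c)=F(X_a,F(X_b,X_c)).$$
   Context: $M^H$ denotes the conjugate transpose of $M$, and $I$ the $n\times n$ identity. A triple $(A,G,H)$ of $n\times n$ complex matrices is identified with the stacked block column with blocks $A,G,H$ in this order; $F(X_a,X_b)$ is again such a triple. Writing $X_d=F(X_a,X_b)=(A_d,G_d,H_d)$ and $X_e=F(X_b,X_c)=(A_e,G_e,H_e)$, "well-defined" means that $I+G_aH_b$, $I+G_bH_c$, $I+G_aH_e$ and $I+G_dH_c$ are all invertible. *)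

theory Defs
  imports "HOL-Analysis.Analysis"
begin

type_synonym 'n cmat = "complex ^ 'n ^ 'n"

definition conj_transpose :: "'n::finite cmat \<Rightarrow> 'n cmat"
  where "conj_transpose M = (\<chi> i j. cnj (M $ j $ i))"

definition hermitian :: "'n::finite cmat \<Rightarrow> bool"
  where "hermitian M \<longleftrightarrow> conj_transpose M = M"

text \<open>The quadratic form of a Hermitian matrix is real-valued, so taking its real part
  below loses nothing.\<close>

definition hermitian_pos_def :: "'n::finite cmat \<Rightarrow> bool"
  where "hermitian_pos_def M \<longleftrightarrow>
    hermitian M \<and> (\<forall>v. v \<noteq> 0 \<longrightarrow> 0 < Re (\<Sum>i\<in>UNIV. cnj (v $ i) * (M *v v) $ i))"

text \<open>A triple \<open>(A, G, H)\<close> stands for the block column with blocks A, G, H.\<close>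

type_synonym 'n triple = "'n cmat \<times> 'n cmat \<times> 'n cmat"

definition A_of :: "'n triple \<Rightarrow> 'n cmat" where "A_of X = fst X"
definition G_of :: "'n triple \<Rightarrow> 'n cmat" where "G_of X = fst (snd X)"
definition H_of :: "'n triple \<Rightarrow> 'n cmat" where "H_of X = snd (snd X)"

text \<open>\<^const>\<open>matrix_inv\<close> is total; it is the inverse only if \<open>I + G\<^sub>a H\<^sub>b\<close> is invertible.\<close>

definition Delta :: "'n::finite triple \<Rightarrow> 'n triple \<Rightarrow> 'n cmat"
  where "Delta Xa Xb = matrix_inv (mat 1 + G_of Xa ** H_of Xb)"

definition F :: "'n::finite triple \<Rightarrow> 'n triple \<Rightarrow> 'n triple"
  where "F Xa Xb =
    (A_of Xb ** Delta Xa Xb ** A_of Xa,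
     G_of Xb + A_of Xb ** Delta Xa Xb ** G_of Xa ** conj_transpose (A_of Xb),
     H_of Xa + conj_transpose (A_of Xa) ** H_of Xb ** Delta Xa Xb ** A_of Xa)"

end

theory Submission
  imports Defs
begin

text \<open>
  Write \<open>P\<close>, \<open>Q\<close>, \<open>R\<close>, \<open>S\<close> for the inverses \<open>\<Delta>\<close> of the pairs \<open>(a,b)\<close>, \<open>(b,c)\<close>, \<open>(d,c)\<close>, \<open>(a,e)\<close>.
  Inserting the components of \<open>X\<^sub>d = F(X\<^sub>a,X\<^sub>b)\<close> and \<open>X\<^sub>e = F(X\<^sub>b,X\<^sub>c)\<close> shows that the two outer
  inverses are those of perturbations of the inner ones:
  \<open>R\<^sup>-\<^sup>1 = Q\<^sup>-\<^sup>1 + A\<^sub>b P G\<^sub>a A\<^sub>b\<^sup>H H\<^sub>c\<close> and \<open>S\<^sup>-\<^sup>1 = P\<^sup>-\<^sup>1 + G\<^sub>a A\<^sub>b\<^sup>H H\<^sub>c Q A\<^sub>b\<close>.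
  Hence \<open>R\<^sup>-\<^sup>1 Q A\<^sub>b\<close> and \<open>A\<^sub>b P S\<^sup>-\<^sup>1\<close> are the same matrix, which gives the exchange law
  \<open>R A\<^sub>b P = Q A\<^sub>b S\<close> (lemma \<open>outer_inverses_exchange\<close>). This is already equality of the
  \<open>A\<close>-components, up to the outer factors \<open>A\<^sub>c\<close> and \<open>A\<^sub>a\<close>.

  The \<open>G\<close>- and \<open>H\<close>-components also contain \<open>Q\<^sup>H\<close> and \<open>P\<^sup>H\<close>. The Woodbury identity
  \<open>(I + H G)\<^sup>-\<^sup>1 = I - H (I + G H)\<^sup>-\<^sup>1 G\<close> expresses these through \<open>Q\<close> and \<open>P\<close> when \<open>G\<close> and \<open>H\<close> are
  Hermitian (lemma \<open>conj_transpose_inverse_id_plus_mult\<close>); with the exchange law both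
  components then reduce to distributivity (lemmas \<open>outer_G_block\<close> and \<open>outer_H_block\<close>).
\<close>

lemma matrix_add_rdistrib:
  fixes A B :: "'a::semiring_1 ^ 'n ^ 'm"
  shows "(A + B) ** C = A ** C + B ** C"
  by (simp add: matrix_matrix_mult_def vec_eq_iff distrib_right sum.distrib)

lemma matrix_sub_rdistrib:
  fixes A B :: "'a::ring_1 ^ 'n ^ 'm"
  shows "(A - B) ** C = A ** C - B ** C"
  by (simp add: matrix_matrix_mult_def vec_eq_iff left_diff_distrib sum_subtractf)

lemma matrix_sub_ldistrib:
  fixes A :: "'a::ring_1 ^ 'n ^ 'm"
  shows "A ** (B - C) = A ** B - A ** C"
  by (simp add: matrix_matrix_mult_def vec_eq_iff right_diff_distrib sum_subtractf)

lemma conj_transpose_mult: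
  "conj_transpose (M ** N) = conj_transpose N ** conj_transpose M"
  by (simp add: conj_transpose_def matrix_matrix_mult_def vec_eq_iff mult.commute)

lemma conj_transpose_add:
  "conj_transpose (M + N) = conj_transpose M + conj_transpose N"
  by (simp add: conj_transpose_def vec_eq_iff)

lemma conj_transpose_id: "conj_transpose (mat 1) = mat 1"
  by (auto simp: conj_transpose_def mat_def vec_eq_iff)

lemma
  fixes M :: "'a::semiring_1 ^ 'n ^ 'm"
  assumes "invertible M"
  shows matrix_inv_right: "M ** matrix_inv M = mat 1"
    and matrix_inv_left: "matrix_inv M ** M = mat 1"
  using someI_ex[OF assms[unfolded invertible_def]] by (simp_all add: matrix_inv_def)

lemma inverse_exchange:
  fixes M N X Y :: "'a::semiring_1 ^ 'n::finite ^ 'n"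
  assumes "invertible M" "invertible N" "M ** X = Y ** N"
  shows "matrix_inv M ** Y = X ** matrix_inv N"
proof -
  have "matrix_inv M ** Y = matrix_inv M ** (Y ** N) ** matrix_inv N"
    using assms(2) by (simp add: matrix_mul_assoc[symmetric] matrix_inv_right)
  also have "\<dots> = matrix_inv M ** (M ** X) ** matrix_inv N"
    using assms(3) by simp
  also have "\<dots> = X ** matrix_inv N"
    using assms(1) by (simp add: matrix_mul_assoc matrix_inv_left)
  finally show ?thesis .
qed

text \<open>
  The left-hand side is a right inverse of \<open>I + H G = (I + G H)\<^sup>H\<close>. The right-hand side is a left
  inverse of it, by \<open>H D G (I + H G) = H D (I + G H) G = H G\<close>.
\<close>

lemma conj_transpose_inverse_id_plus_mult:
  fixes G H :: "'n::finite cmat"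
  assumes "hermitian G" "hermitian H" and inv: "invertible (mat 1 + G ** H)"
  defines "D \<equiv> matrix_inv (mat 1 + G ** H)"
  shows "conj_transpose D = mat 1 - H ** D ** G"
proof -
  have DK: "D ** (mat 1 + G ** H) = mat 1"
    using inv by (simp add: D_def matrix_inv_left)
  have adj: "conj_transpose (mat 1 + G ** H) = mat 1 + H ** G"
    using assms(1,2)
    by (simp add: hermitian_def conj_transpose_add conj_transpose_mult conj_transpose_id)
  have right: "(mat 1 + H ** G) ** conj_transpose D = mat 1"
    using arg_cong[OF DK, of conj_transpose]
    by (simp only: conj_transpose_mult conj_transpose_id adj)
  have "H ** D ** G ** (mat 1 + H ** G) = H ** (D ** (mat 1 + G ** H)) ** G"
    by (simp add: matrix_mul_assoc matrix_add_ldistrib matrix_add_rdistrib)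
  then have left: "(mat 1 - H ** D ** G) ** (mat 1 + H ** G) = mat 1"
    by (simp add: DK matrix_sub_rdistrib)
  have "conj_transpose D
      = (mat 1 - H ** D ** G) ** (mat 1 + H ** G) ** conj_transpose D"
    by (simp add: left)
  also have "\<dots> = mat 1 - H ** D ** G"
    by (simp only: matrix_mul_assoc[symmetric] right matrix_mul_rid)
  finally show ?thesis .
qed

text \<open>
  Here \<open>B\<close> and \<open>T\<close> stand for \<open>A\<^sub>b\<close> and \<open>A\<^sub>b\<^sup>H\<close>. Both \<open>M Q B\<close> and \<open>B P N\<close> expand to
  \<open>B + B P G\<^sub>a T H\<^sub>c Q B\<close>.
\<close>

lemma outer_inverses_exchange:
  fixes B T Ga Gb Hb Hc :: "'a::ring_1 ^ 'n::finite ^ 'n"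
  defines "P \<equiv> matrix_inv (mat 1 + Ga ** Hb)"
    and "Q \<equiv> matrix_inv (mat 1 + Gb ** Hc)"
  defines "M \<equiv> mat 1 + (Gb + B ** P ** Ga ** T) ** Hc"
    and "N \<equiv> mat 1 + Ga ** (Hb + T ** Hc ** Q ** B)"
  assumes "invertible (mat 1 + Ga ** Hb)" "invertible (mat 1 + Gb ** Hc)"
    and "invertible M" "invertible N"
  shows "matrix_inv M ** B ** P = Q ** B ** matrix_inv N"
proof -
  have P: "P ** (mat 1 + Ga ** Hb) = mat 1" and Q: "(mat 1 + Gb ** Hc) ** Q = mat 1"
    using assms(5,6) by (simp_all add: P_def Q_def matrix_inv_left matrix_inv_right)
  have "M ** (Q ** B) = (mat 1 + Gb ** Hc) ** Q ** B + B ** P ** Ga ** T ** Hc ** Q ** B"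
    by (simp add: M_def matrix_mul_assoc matrix_add_ldistrib matrix_add_rdistrib)
  also have "\<dots> = B ** (P ** (mat 1 + Ga ** Hb)) + B ** P ** Ga ** T ** Hc ** Q ** B"
    by (simp add: P Q)
  also have "\<dots> = B ** P ** N"
    by (simp add: N_def matrix_mul_assoc matrix_add_ldistrib)
  finally show ?thesis
    using inverse_exchange[OF assms(7,8), of "Q ** B" "B ** P"]
    by (simp add: matrix_mul_assoc)
qed

text \<open>
  With \<open>U = A\<^sub>b P G\<^sub>a A\<^sub>b\<^sup>H\<close> the claim is the resolvent identity for the perturbation \<open>U H\<^sub>c\<close> of
  \<open>I + G\<^sub>b H\<^sub>c\<close>. It follows by applying \<open>(I + (G\<^sub>b + U) H\<^sub>c)\<^sup>-\<^sup>1\<close> to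
  \<open>G\<^sub>b + U = (I + (G\<^sub>b + U) H\<^sub>c) Q G\<^sub>b + U (I - H\<^sub>c Q G\<^sub>b)\<close>.
\<close>

lemma outer_G_block:
  fixes U Gb Hc :: "'a::ring_1 ^ 'n::finite ^ 'n"
  defines "Q \<equiv> matrix_inv (mat 1 + Gb ** Hc)"
  defines "M \<equiv> mat 1 + (Gb + U) ** Hc"
  assumes "invertible (mat 1 + Gb ** Hc)" "invertible M"
  shows "matrix_inv M ** (Gb + U)
       = Q ** Gb + matrix_inv M ** U ** (mat 1 - Hc ** Q ** Gb)"
proof -
  have Q: "(mat 1 + Gb ** Hc) ** Q = mat 1"
    using assms(3) by (simp add: Q_def matrix_inv_right)
  have "M ** (Q ** Gb) = (mat 1 + Gb ** Hc) ** Q ** Gb + U ** Hc ** Q ** Gb"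
    by (simp add: M_def matrix_mul_assoc matrix_add_ldistrib matrix_add_rdistrib)
  then have "Gb + U = M ** (Q ** Gb) + U ** (mat 1 - Hc ** Q ** Gb)"
    by (simp add: Q matrix_mul_assoc matrix_sub_ldistrib)
  then have "matrix_inv M ** (Gb + U)
      = matrix_inv M ** (M ** (Q ** Gb) + U ** (mat 1 - Hc ** Q ** Gb))"
    by simp
  also have "\<dots> = matrix_inv M ** M ** (Q ** Gb)
      + matrix_inv M ** U ** (mat 1 - Hc ** Q ** Gb)"
    by (simp only: matrix_mul_assoc matrix_add_ldistrib)
  finally show ?thesis
    using assms(4) by (simp add: matrix_inv_left)
qed

text \<open>
  The mirror image of the preceding lemma, with all products reversed, for the perturbation
  \<open>V = A\<^sub>b\<^sup>H H\<^sub>c Q A\<^sub>b\<close> of \<open>H\<^sub>b\<close>. It follows by applying \<open>(I + G\<^sub>a (H\<^sub>b + V))\<^sup>-\<^sup>1\<close> from the right to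
  \<open>H\<^sub>b + V = H\<^sub>b P (I + G\<^sub>a (H\<^sub>b + V)) + (I - H\<^sub>b P G\<^sub>a) V\<close>.
\<close>

lemma outer_H_block:
  fixes V Ga Hb :: "'a::ring_1 ^ 'n::finite ^ 'n"
  defines "P \<equiv> matrix_inv (mat 1 + Ga ** Hb)"
  defines "N \<equiv> mat 1 + Ga ** (Hb + V)"
  assumes "invertible (mat 1 + Ga ** Hb)" "invertible N"
  shows "(Hb + V) ** matrix_inv N
       = Hb ** P + (mat 1 - Hb ** P ** Ga) ** V ** matrix_inv N"
proof -
  have P: "P ** (mat 1 + Ga ** Hb) = mat 1"
    using assms(3) by (simp add: P_def matrix_inv_left)
  have "Hb ** P ** N = Hb ** (P ** (mat 1 + Ga ** Hb)) + Hb ** P ** Ga ** V"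
    by (simp add: N_def matrix_mul_assoc matrix_add_ldistrib)
  then have "Hb + V = Hb ** P ** N + (mat 1 - Hb ** P ** Ga) ** V"
    by (simp add: P matrix_sub_rdistrib)
  then have "(Hb + V) ** matrix_inv N
      = (Hb ** P ** N + (mat 1 - Hb ** P ** Ga) ** V) ** matrix_inv N"
    by simp
  also have "\<dots> = Hb ** P ** (N ** matrix_inv N)
      + (mat 1 - Hb ** P ** Ga) ** V ** matrix_inv N"
    by (simp only: matrix_mul_assoc matrix_add_rdistrib)
  finally show ?thesis
    using assms(4) by (simp add: matrix_inv_right)
qed

theorem theorem4p2:
  fixes Xa Xb Xc :: "'n::finite triple"
  assumes "hermitian_pos_def (G_of Xa)" and "hermitian_pos_def (H_of Xa)"
    and "hermitian_pos_def (G_of Xb)" and "hermitian_pos_def (H_of Xb)"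
    and "hermitian_pos_def (G_of Xc)" and "hermitian_pos_def (H_of Xc)"
    and "invertible (mat 1 + G_of Xa ** H_of Xb)"
    and "invertible (mat 1 + G_of Xb ** H_of Xc)"
    and "invertible (mat 1 + G_of Xa ** H_of (F Xb Xc))"
    and "invertible (mat 1 + G_of (F Xa Xb) ** H_of Xc)"
  shows "F (F Xa Xb) Xc = F Xa (F Xb Xc)"
proof -
  obtain A Ga Ha where Xa: "Xa = (A, Ga, Ha)" by (cases Xa) auto
  obtain B Gb Hb where Xb: "Xb = (B, Gb, Hb)" by (cases Xb) auto
  obtain C Gc Hc where Xc: "Xc = (C, Gc, Hc)" by (cases Xc) auto
  note sel = A_of_def G_of_def H_of_def
  let ?T = "conj_transpose B"
  define P where "P = matrix_inv (mat 1 + Ga ** Hb)"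
  define Q where "Q = matrix_inv (mat 1 + Gb ** Hc)"
  define M where "M = mat 1 + (Gb + B ** P ** Ga ** ?T) ** Hc"
  define N where "N = mat 1 + Ga ** (Hb + ?T ** Hc ** Q ** B)"
  define R where "R = matrix_inv M"
  define S where "S = matrix_inv N"
  have herm: "hermitian Ga" "hermitian Gb" "hermitian Hb" "hermitian Hc"
    using assms(1,3,4,6) by (simp_all add: hermitian_pos_def_def Xa Xb Xc sel)
  have Fab: "F Xa Xb = (B ** P ** A, Gb + B ** P ** Ga ** ?T,
      Ha + conj_transpose A ** Hb ** P ** A)"
    by (simp add: F_def Delta_def Xa Xb sel P_def)
  have Fbc: "F Xb Xc = (C ** Q ** B, Gc + C ** Q ** Gb ** conj_transpose C,
      Hb + ?T ** Hc ** Q ** B)"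
    by (simp add: F_def Delta_def Xb Xc sel Q_def)
  have inv: "invertible (mat 1 + Ga ** Hb)" "invertible (mat 1 + Gb ** Hc)"
    "invertible M" "invertible N"
    using assms(7-10) unfolding Fab Fbc by (simp_all add: Xa Xb Xc sel M_def N_def)
  have Pstar: "conj_transpose P = mat 1 - Hb ** P ** Ga"
    using conj_transpose_inverse_id_plus_mult[OF herm(1,3) inv(1)] by (simp add: P_def)
  have Qstar: "conj_transpose Q = mat 1 - Hc ** Q ** Gb"
    using conj_transpose_inverse_id_plus_mult[OF herm(2,4) inv(2)] by (simp add: Q_def)
  have exch: "R ** B ** P = Q ** B ** S"
    using outer_inverses_exchange[of Ga Hb Gb Hc B ?T] inv
    by (simp add: P_def Q_def M_def N_def R_def S_def)
  have G: "R ** (Gb + B ** P ** Ga ** ?T)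
      = Q ** Gb + Q ** B ** S ** Ga ** ?T ** conj_transpose Q"
    using outer_G_block[of Gb Hc "B ** P ** Ga ** ?T"] inv
    by (simp add: Q_def[symmetric] M_def[symmetric] R_def[symmetric] Qstar[symmetric]
        matrix_mul_assoc exch)
  have H: "(Hb + ?T ** Hc ** Q ** B) ** S
      = Hb ** P + conj_transpose P ** ?T ** Hc ** R ** B ** P"
  proof -
    have "(Hb + ?T ** Hc ** Q ** B) ** S
        = Hb ** P + conj_transpose P ** ?T ** Hc ** (Q ** B ** S)"
      using outer_H_block[of Ga Hb "?T ** Hc ** Q ** B"] inv
      by (simp add: P_def[symmetric] N_def[symmetric] S_def[symmetric] Pstar[symmetric]
          matrix_mul_assoc)
    then show ?thesis by (simp add: exch[symmetric] matrix_mul_assoc)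
  qed
  have left: "F (F Xa Xb) Xc = (C ** R ** (B ** P ** A),
      Gc + C ** (R ** (Gb + B ** P ** Ga ** ?T)) ** conj_transpose C,
      Ha + conj_transpose A ** Hb ** P ** A
         + conj_transpose (B ** P ** A) ** Hc ** R ** (B ** P ** A))"
    unfolding Fab by (simp add: F_def Delta_def Xc sel R_def M_def matrix_mul_assoc)
  have right: "F Xa (F Xb Xc) = (C ** Q ** B ** S ** A,
      Gc + C ** Q ** Gb ** conj_transpose C
         + C ** Q ** B ** S ** Ga ** conj_transpose (C ** Q ** B),
      Ha + conj_transpose A ** ((Hb + ?T ** Hc ** Q ** B) ** S) ** A)"
    unfolding Fbc by (simp add: F_def Delta_def Xa sel S_def N_def matrix_mul_assoc)
  have "C ** R ** (B ** P ** A) = C ** (R ** B ** P) ** A"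
    by (simp add: matrix_mul_assoc)
  then have "C ** R ** (B ** P ** A) = C ** Q ** B ** S ** A"
    by (simp add: exch matrix_mul_assoc)
  then show ?thesis
    unfolding left right G H
    by (simp add: conj_transpose_mult matrix_mul_assoc matrix_add_ldistrib
        matrix_add_rdistrib add.assoc)
qed

end
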